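(* Let $n\ge 1$ and let $L$ be the largest integer with $2^L L^2\le n$. Consider the density estimation model in which, given $P$, the observations $X_1,\dots,X_n$ are i.i.d. from $P$ on $(0,1]$, and let $P$ be drawn from the Spike and Slab Pólya tree prior truncated at level $L$ specified through independent variables $$Y_{\varepsilon0}\sim (1-\pi_{\varepsilon0})\,\delta_{1/2}+\pi_{\varepsilon0}\,\mathrm{Beta}(\alpha_{\varepsilon0},\alpha_{\varepsilon1}),\qquad |\varepsilon|\le L-1,$$ with positive integers $\alpha_\varepsilon$ and $\pi_{\varepsilon0}\in(0,1]$. Then the posterior distribution of $P$ given $X_1,\dots,X_n$ is again a Spike and Slab Pólya tree distribution truncated at level $L$, specified through independent variables $\tilde Y_{\varepsilon0}$ with, for every finite binary word $\varepsilon$ with $|\varepsilon|\le L-1$, $$\tilde Y_{\varepsilon0}\sim (1-\tilde\pi_{\varepsilon0})\,\delta_{1/2}+\tilde\pi_{\varepsilon0}\,\mathrm{Beta}(\alpha_{\varepsilon0}(X),\alpha_{\varepsilon1}(X)),$$ where $\alpha_\varepsilon(X)=N_X(I_\varepsilon)+\alpha_\varepsilon$, $N_X(I_\varepsilon)=\sum_{i=1}^n \mathbf 1_{X_i\in I_\varepsilon}$, and $$\tilde\pi_{\varepsilon0}=\frac{\pi_{\varepsilon0}T_X}{(1-\pi_{\varepsilon0})+\pi_{\varepsilon0}T_X},\qquad T_X=T(\varepsilon,X)=2^{N_X(I_\varepsilon)}\,\frac{B(\alpha_{\varepsilon0}(X),\alpha_{\varepsilon1}(X))}{B(\alpha_{\varepsilon0},\alpha_{\varepsilon1})},$$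 with $B$ the Beta function.
   Context: Finite binary words (including the empty word $\emptyset$) are denoted $\varepsilon=\varepsilon_1\cdots\varepsilon_l$, with length $|\varepsilon|=l$; $\varepsilon0,\varepsilon1$ are $\varepsilon$ with $0$ or $1$ appended. Put $I_\emptyset=(0,1]$ and, if $|\varepsilon|=l$ and $k2^{-l}=\sum_{i=1}^l\varepsilon_i2^{-i}$, $I_\varepsilon=(k2^{-l},(k+1)2^{-l}]$. Spike and Slab Pólya tree truncated at level $L$: given independent $[0,1]$-valued variables $Y_{\varepsilon0}$, $|\varepsilon|\le L-1$, each distributed as a mixture $(1-p_{\varepsilon0})\delta_{1/2}+p_{\varepsilon0}\mathrm{Beta}(a_{\varepsilon0},a_{\varepsilon1})$ (with weights $p_{\varepsilon 0}\in[0,1]$ and positive integer parameters), set $Y_{\varepsilon1}=1-Y_{\varepsilon0}$ and $P(I_\varepsilon)=\prod_{j=1}^{|\varepsilon|}Y_{\varepsilon_1\cdots\varepsilon_j}$ for $|\varepsilon|\le L$. $P$ is then the (random) probability measure on $(0,1]$ with these masses which is absolutely continuous with respect to Lebesgue measure with density constant on each $I_\varepsilon$, $|\varepsilon|=L$. *)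

theory Defs
  imports "HOL-Probability.Probability"
begin

section \<open>Dyadic intervals\<close>

text \<open>
  Binary words are boolean lists, with \<open>True\<close> for the digit 1; \<open>\<epsilon> @ [False]\<close> is the word
  \<open>\<epsilon>0\<close> and \<open>\<epsilon> @ [True]\<close> is the word \<open>\<epsilon>1\<close>.
\<close>

definition left_end :: "bool list \<Rightarrow> real" where
  "left_end \<epsilon> = (\<Sum>i<length \<epsilon>. of_bool (\<epsilon> ! i) / 2 ^ (i + 1))"

definition dyadic :: "bool list \<Rightarrow> real set" where
  "dyadic \<epsilon> = {left_end \<epsilon> <.. left_end \<epsilon> + 1 / 2 ^ length \<epsilon>}"

text \<open>
  Lebesgue measure on the sample space \<open>(0,1]\<close>. It also serves as the underlying measurable
  space (with its Borel sets) wherever only the sigma-algebra matters.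
\<close>

definition unit_leb :: "real measure" where
  "unit_leb = restrict_space lborel {0<..1}"

section \<open>Spike and slab variables\<close>

text \<open>The variables take values in the closed interval \<open>[0,1]\<close>.\<close>

definition beta_measure :: "real \<Rightarrow> real \<Rightarrow> real measure" where
  "beta_measure a b = density (restrict_space lborel {0..1})
     (\<lambda>y. ennreal (y powr (a - 1) * (1 - y) powr (b - 1) / Beta a b))"

definition spike_slab :: "real \<Rightarrow> real \<Rightarrow> real \<Rightarrow> real measure" where
  "spike_slab p a b = measure_pmf (bernoulli_pmf p) \<bind>
     (\<lambda>slab. if slab then beta_measure a b else return (restrict_space borel {0..1}) (1/2))"

section \<open>Spike and slab Polya trees\<close>

text \<open>
  A family \<open>y\<close> of splitting variables is indexed by the word being split: \<open>y \<epsilon>\<close> is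
  $Y_{\varepsilon 0}$. Then \<open>branch y\<close>, defined on nonempty words, gives $Y_{\varepsilon 0}$ at
  \<open>\<epsilon>0\<close> and $Y_{\varepsilon 1} = 1 - Y_{\varepsilon 0}$ at \<open>\<epsilon>1\<close>.
\<close>

definition branch :: "(bool list \<Rightarrow> real) \<Rightarrow> bool list \<Rightarrow> real" where
  "branch y \<delta> = (if last \<delta> then 1 - y (butlast \<delta>) else y (butlast \<delta>))"

definition cell_mass :: "(bool list \<Rightarrow> real) \<Rightarrow> bool list \<Rightarrow> real" where
  "cell_mass y \<epsilon> = (\<Prod>j = 1..length \<epsilon>. branch y (take j \<epsilon>))"

text \<open>
  The density is \<open>2\<^sup>L P(I\<^sub>\<epsilon>)\<close> on each cell of level \<open>L\<close>, as each of these has length \<open>2\<^sup>-\<^sup>L\<close>.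
\<close>

definition tree_measure :: "nat \<Rightarrow> (bool list \<Rightarrow> real) \<Rightarrow> real measure" where
  "tree_measure L y = density unit_leb
     (\<lambda>x. \<Sum>\<epsilon> | length \<epsilon> = L. ennreal (2 ^ L * cell_mass y \<epsilon>) * indicator (dyadic \<epsilon>) x)"

text \<open>
  The law of the random measure. As with \<open>y\<close>, the weight \<open>p \<epsilon>\<close> is $p_{\varepsilon 0}$, whereas
  \<open>a\<close> is indexed by the nonempty words themselves.
\<close>

definition sspt :: "nat \<Rightarrow> (bool list \<Rightarrow> real) \<Rightarrow> (bool list \<Rightarrow> nat) \<Rightarrow> real measure measure" where
  "sspt L p a = distr
     (PiM {\<epsilon>. length \<epsilon> < L} (\<lambda>\<epsilon>. spike_slab (p \<epsilon>) (a (\<epsilon> @ [False])) (a (\<epsilon> @ [True]))))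
     (prob_algebra unit_leb) (tree_measure L)"

definition sspt_params :: "nat \<Rightarrow> (bool list \<Rightarrow> real) \<Rightarrow> (bool list \<Rightarrow> nat) \<Rightarrow> bool" where
  "sspt_params L p a \<longleftrightarrow>
     (\<forall>\<epsilon>. length \<epsilon> < L \<longrightarrow> p \<epsilon> \<in> {0..1} \<and> 0 < a (\<epsilon> @ [False]) \<and> 0 < a (\<epsilon> @ [True]))"

section \<open>Density estimation model and posterior distributions\<close>

abbreviation sample_space :: "nat \<Rightarrow> (nat \<Rightarrow> real) measure" where
  "sample_space n \<equiv> PiM {..<n} (\<lambda>_. unit_leb)"

text \<open>Joint law of \<open>(P, X)\<close>, where \<open>P \<sim> Q\<close> and \<open>X\<^sub>0, \<dots>, X\<^sub>n\<^sub>-\<^sub>1\<close> are i.i.d. from \<open>P\<close> given \<open>P\<close>.\<close>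

definition joint_law ::
    "nat \<Rightarrow> real measure measure \<Rightarrow> (real measure \<times> (nat \<Rightarrow> real)) measure" where
  "joint_law n Q = Q \<bind> (\<lambda>P. distr (PiM {..<n} (\<lambda>_. P))
     (prob_algebra unit_leb \<Otimes>\<^sub>M sample_space n) (\<lambda>x. (P, x)))"

text \<open>
  \<open>K\<close> is a version of the posterior distribution for the prior \<open>Q\<close>, that is, a regular
  conditional distribution of \<open>P\<close> given \<open>X\<close>. Its uniqueness is only up to sets of samples that
  are null for the marginal law of \<open>X\<close>.
\<close>

definition is_posterior ::
    "nat \<Rightarrow> real measure measure \<Rightarrow> ((nat \<Rightarrow> real) \<Rightarrow> real measure measure) \<Rightarrow> bool" where
  "is_posterior n Q K \<longleftrightarrow>
     K \<in> sample_space n \<rightarrow>\<^sub>M prob_algebra (prob_algebra unit_leb) \<and>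
     (\<forall>A \<in> sets (prob_algebra unit_leb). \<forall>B \<in> sets (sample_space n).
        emeasure (joint_law n Q) (A \<times> B) =
        (\<integral>\<^sup>+x\<in>B. emeasure (K x) A \<partial>distr (joint_law n Q) (sample_space n) snd))"

section \<open>Updated parameters\<close>

definition cell_count :: "nat \<Rightarrow> (nat \<Rightarrow> real) \<Rightarrow> bool list \<Rightarrow> nat" where
  "cell_count n x \<epsilon> = (\<Sum>i<n. indicator (dyadic \<epsilon>) (x i))"

definition post_a :: "nat \<Rightarrow> (nat \<Rightarrow> real) \<Rightarrow> (bool list \<Rightarrow> nat) \<Rightarrow> bool list \<Rightarrow> nat" where
  "post_a n x a \<epsilon> = cell_count n x \<epsilon> + a \<epsilon>"

definition T_stat :: "nat \<Rightarrow> (nat \<Rightarrow> real) \<Rightarrow> (bool list \<Rightarrow> nat) \<Rightarrow> bool list \<Rightarrow> real" where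
  "T_stat n x a \<epsilon> = 2 ^ cell_count n x \<epsilon> *
     (Beta (real (post_a n x a (\<epsilon> @ [False]))) (real (post_a n x a (\<epsilon> @ [True]))) /
      Beta (real (a (\<epsilon> @ [False]))) (real (a (\<epsilon> @ [True]))))"

definition post_p ::
    "nat \<Rightarrow> (nat \<Rightarrow> real) \<Rightarrow> (bool list \<Rightarrow> real) \<Rightarrow> (bool list \<Rightarrow> nat) \<Rightarrow> bool list \<Rightarrow> real" where
  "post_p n x p a \<epsilon> = p \<epsilon> * T_stat n x a \<epsilon> / ((1 - p \<epsilon>) + p \<epsilon> * T_stat n x a \<epsilon>)"

section \<open>Basic properties\<close>

lemma left_end_snoc: "left_end (\<epsilon> @ [b]) = left_end \<epsilon> + of_bool b / 2 ^ (length \<epsilon> + 1)"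
  by (simp add: left_end_def nth_append)

lemma dyadic_Nil: "dyadic [] = {0<..1}"
  by (simp add: dyadic_def left_end_def)

lemma dyadic_split:
  "dyadic \<epsilon> = dyadic (\<epsilon> @ [False]) \<union> dyadic (\<epsilon> @ [True])"
  "dyadic (\<epsilon> @ [False]) \<inter> dyadic (\<epsilon> @ [True]) = {}"
proof -
  have e: "1 / 2 ^ length \<epsilon> = 2 * (1 / 2 ^ (length \<epsilon> + 1) :: real)" by simp
  define h where "h = (1 / 2 ^ (length \<epsilon> + 1) :: real)"
  have h: "h > 0" by (simp add: h_def)
  have d: "dyadic \<epsilon> = {left_end \<epsilon> <.. left_end \<epsilon> + 2 * h}"
    "dyadic (\<epsilon> @ [False]) = {left_end \<epsilon> <.. left_end \<epsilon> + h}"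
    "dyadic (\<epsilon> @ [True]) = {left_end \<epsilon> + h <.. left_end \<epsilon> + h + h}"
    using e by (simp_all add: dyadic_def left_end_snoc h_def)
  show "dyadic \<epsilon> = dyadic (\<epsilon> @ [False]) \<union> dyadic (\<epsilon> @ [True])"
    "dyadic (\<epsilon> @ [False]) \<inter> dyadic (\<epsilon> @ [True]) = {}"
    unfolding d using h by auto
qed

lemma dyadic_disjoint:
  "length \<delta> = length \<epsilon> \<Longrightarrow> \<delta> \<noteq> \<epsilon> \<Longrightarrow> dyadic \<delta> \<inter> dyadic \<epsilon> = {}"
proof (induction \<delta> arbitrary: \<epsilon> rule: rev_induct)
  case (snoc b \<delta>)
  then obtain \<epsilon>' c where \<epsilon>: "\<epsilon> = \<epsilon>' @ [c]" "length \<delta> = length \<epsilon>'"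
    by (cases \<epsilon> rule: rev_cases) auto
  have sub: "dyadic (\<zeta> @ [d]) \<subseteq> dyadic \<zeta>" for \<zeta> d
    using dyadic_split(1)[of \<zeta>] by (cases d) auto
  show ?case
  proof (cases "\<delta> = \<epsilon>'")
    case True
    with snoc.prems \<epsilon> have "b \<noteq> c" by auto
    with True \<epsilon> dyadic_split(2)[of \<delta>] show ?thesis by (cases b; cases c) auto
  next
    case False
    with snoc.IH \<epsilon> have "dyadic \<delta> \<inter> dyadic \<epsilon>' = {}" by auto
    with sub[of \<delta> b] sub[of \<epsilon>' c] \<epsilon> show ?thesis by auto
  qed
qed auto

lemma dyadic_subset: "dyadic \<epsilon> \<subseteq> {0<..1}"
proof (induction \<epsilon> rule: rev_induct)
  case (snoc b \<epsilon>)
  then show ?case using dyadic_split(1)[of \<epsilon>] by (cases b) auto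
qed (simp add: dyadic_Nil)

lemma cell_mass_snoc: "cell_mass y (\<epsilon> @ [b]) = cell_mass y \<epsilon> * (if b then 1 - y \<epsilon> else y \<epsilon>)"
proof -
  have "(\<Prod>j = 1..length \<epsilon>. branch y (take j (\<epsilon> @ [b]))) = cell_mass y \<epsilon>"
    unfolding cell_mass_def by (intro prod.cong) auto
  then have "cell_mass y (\<epsilon> @ [b]) = cell_mass y \<epsilon> * branch y (\<epsilon> @ [b])"
    unfolding cell_mass_def[of y "\<epsilon> @ [b]"] by simp
  then show ?thesis by (simp add: branch_def)
qed

lemma dyadic_sets [measurable]: "dyadic \<epsilon> \<in> sets unit_leb"
  using dyadic_subset by (auto simp: unit_leb_def sets_restrict_space_iff dyadic_def)

lemma emeasure_unit_leb_dyadic: "emeasure unit_leb (dyadic \<epsilon>) = ennreal (1 / 2 ^ length \<epsilon>)"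
  unfolding unit_leb_def using dyadic_subset[of \<epsilon>]
  by (subst emeasure_restrict_space) (auto simp: dyadic_def)

lemma finite_words: "finite {\<epsilon> :: bool list. length \<epsilon> = L}"
  using finite_lists_length_eq[of "UNIV :: bool set" L] by simp

text \<open>The splitting variables determine the masses of the dyadic intervals as intended.\<close>

lemma emeasure_tree_measure_dyadic:
  assumes y: "\<And>\<epsilon>. length \<epsilon> < L \<Longrightarrow> y \<epsilon> \<in> {0..1}"
  shows "length \<epsilon> \<le> L \<Longrightarrow> emeasure (tree_measure L y) (dyadic \<epsilon>) = ennreal (cell_mass y \<epsilon>)"
proof (induction "L - length \<epsilon>" arbitrary: \<epsilon>)
  case 0
  then have l: "length \<epsilon> = L" by simp
  have "emeasure (tree_measure L y) (dyadic \<epsilon>) =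
    (\<integral>\<^sup>+x. (\<Sum>\<delta> | length \<delta> = L. ennreal (2 ^ L * cell_mass y \<delta>) * indicator (dyadic \<delta>) x)
       * indicator (dyadic \<epsilon>) x \<partial>unit_leb)"
    unfolding tree_measure_def by (subst emeasure_density) auto
  also have "\<dots> = (\<integral>\<^sup>+x. ennreal (2 ^ L * cell_mass y \<epsilon>) * indicator (dyadic \<epsilon>) x \<partial>unit_leb)"
  proof (intro nn_integral_cong)
    fix x
    have "(\<Sum>\<delta> | length \<delta> = L. ennreal (2 ^ L * cell_mass y \<delta>) * indicator (dyadic \<delta>) x)
       = ennreal (2 ^ L * cell_mass y \<epsilon>)" if "x \<in> dyadic \<epsilon>"
    proof -
      have "indicator (dyadic \<delta>) x = (0 :: ennreal)" if "length \<delta> = L" "\<delta> \<noteq> \<epsilon>" for \<delta>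
        using dyadic_disjoint[of \<delta> \<epsilon>] that l \<open>x \<in> dyadic \<epsilon>\<close> by (auto simp: indicator_def)
      then show ?thesis
        using that l finite_words[of L]
        by (subst sum.remove[of _ \<epsilon>]) (auto intro!: sum.neutral)
    qed
    then show "(\<Sum>\<delta> | length \<delta> = L. ennreal (2 ^ L * cell_mass y \<delta>) * indicator (dyadic \<delta>) x)
       * indicator (dyadic \<epsilon>) x = ennreal (2 ^ L * cell_mass y \<epsilon>) * indicator (dyadic \<epsilon>) x"
      by (auto simp: indicator_def)
  qed
  also have "\<dots> = ennreal (2 ^ L * cell_mass y \<epsilon>) * ennreal (1 / 2 ^ L)"
    by (subst nn_integral_cmult_indicator) (auto simp: emeasure_unit_leb_dyadic l)
  also have "\<dots> = ennreal (cell_mass y \<epsilon>)"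
    by (subst ennreal_mult''[symmetric]) auto
  finally show ?case .
next
  case (Suc k)
  have nn: "0 \<le> cell_mass y \<delta>" if "length \<delta> \<le> L" for \<delta>
    using that
  proof (induction \<delta> rule: rev_induct)
    case (snoc b \<delta>)
    then show ?case using y[of \<delta>] by (simp add: cell_mass_snoc)
  qed (simp add: cell_mass_def)
  have lt: "length \<epsilon> < L" using Suc by simp
  have "emeasure (tree_measure L y) (dyadic \<epsilon>) =
    emeasure (tree_measure L y) (dyadic (\<epsilon> @ [False])) + emeasure (tree_measure L y) (dyadic (\<epsilon> @ [True]))"
    by (subst dyadic_split(1), rule plus_emeasure[symmetric])
       (auto simp: tree_measure_def dyadic_split(2))
  also have "\<dots> = ennreal (cell_mass y (\<epsilon> @ [False])) + ennreal (cell_mass y (\<epsilon> @ [True]))"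
    using Suc by simp
  also have "\<dots> = ennreal (cell_mass y \<epsilon>)"
    using lt nn[of "\<epsilon> @ [False]"] nn[of "\<epsilon> @ [True]"]
    by (subst ennreal_plus[symmetric]) (simp_all add: cell_mass_snoc algebra_simps)
  finally show ?case .
qed

lemma prob_space_beta_measure:
  assumes "0 < a" "0 < b"
  shows "prob_space (beta_measure a b)"
proof
  have B: "Beta a b > 0" using assms by (simp add: Beta_def)
  have "((\<lambda>t. t powr (a - 1) * (1 - t) powr (b - 1) / Beta a b) has_integral 1) {0..1}"
    using has_integral_divide[OF has_integral_Beta_real[OF assms], of "Beta a b"] B by simp
  then have "(\<integral>\<^sup>+t. ennreal (t powr (a - 1) * (1 - t) powr (b - 1) / Beta a b)
      * indicator {0..1} t \<partial>lborel) = ennreal 1"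
    using B by (intro nn_integral_has_integral_lebesgue') auto
  then show "emeasure (beta_measure a b) (space (beta_measure a b)) = 1"
    unfolding beta_measure_def
    by (subst emeasure_density)
       (auto simp: nn_integral_restrict_space sets_restrict_space indicator_def mult.assoc
         simp flip: of_bool_conj intro!: measurable_restrict_space1)
qed

lemma emeasure_spike_slab:
  assumes "0 < a" "0 < b" "p \<in> {0..1}" "A \<in> sets (restrict_space borel {0..1})"
  shows "emeasure (spike_slab p a b) A =
    ennreal (1 - p) * indicator A (1/2) + ennreal p * emeasure (beta_measure a b) A"
proof -
  have sets: "sets (beta_measure a b) = sets (restrict_space borel {0..1})"
    by (simp add: beta_measure_def sets_restrict_space)
  interpret prob_space "beta_measure a b" using assms prob_space_beta_measure by blast
  have "beta_measure a b \<in> space (subprob_algebra (restrict_space borel {0..1}))"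
    by (simp add: space_subprob_algebra sets subprob_space_axioms)
  moreover have "return (restrict_space borel {0..1}) (1/2) \<in>
      space (subprob_algebra (restrict_space borel {0..1 :: real}))"
    by (auto simp: space_subprob_algebra space_restrict_space
        intro!: prob_space_imp_subprob_space prob_space_return)
  ultimately have "emeasure (spike_slab p a b) A = (\<integral>\<^sup>+slab. emeasure
      (if slab then beta_measure a b else return (restrict_space borel {0..1}) (1/2)) A
      \<partial>measure_pmf (bernoulli_pmf p))"
    unfolding spike_slab_def using assms
    by (intro emeasure_bind[where N = "restrict_space borel {0..1}"]) auto
  then show ?thesis
    using assms by (simp add: nn_integral_bernoulli_pmf mult.commute add.commute)
qed

lemma emeasure_tree_measure:
  assumes [measurable]: "A \<in> sets unit_leb"
  shows "emeasure (tree_measure L y) A =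
    (\<Sum>\<epsilon> | length \<epsilon> = L. ennreal (2 ^ L * cell_mass y \<epsilon>) * emeasure unit_leb (dyadic \<epsilon> \<inter> A))"
proof -
  have "emeasure (tree_measure L y) A =
    (\<integral>\<^sup>+x. (\<Sum>\<epsilon> | length \<epsilon> = L. ennreal (2 ^ L * cell_mass y \<epsilon>) * indicator (dyadic \<epsilon> \<inter> A) x) \<partial>unit_leb)"
    unfolding tree_measure_def
    by (subst emeasure_density)
       (auto simp: sum_distrib_right indicator_inter_arith mult.assoc)
  also have "\<dots> = (\<Sum>\<epsilon> | length \<epsilon> = L. ennreal (2 ^ L * cell_mass y \<epsilon>) * emeasure unit_leb (dyadic \<epsilon> \<inter> A))"
    by (subst nn_integral_sum) (auto simp: nn_integral_cmult_indicator)
  finally show ?thesis .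
qed

lemma sets_spike_slab: "sets (spike_slab p a b) = sets (restrict_space borel {0..1})"
  unfolding spike_slab_def by (rule sets_bind) (auto simp: beta_measure_def sets_restrict_space)

lemma tree_measure_measurable:
  assumes M: "\<And>\<epsilon>. length \<epsilon> < L \<Longrightarrow> sets (M \<epsilon>) = sets (restrict_space borel {0..1})"
  shows "tree_measure L \<in> PiM {\<epsilon>. length \<epsilon> < L} M \<rightarrow>\<^sub>M prob_algebra unit_leb"
proof -
  define J where "J = {\<epsilon> :: bool list. length \<epsilon> < L}"
  have sp: "space (M \<epsilon>) = {0..1}" if "\<epsilon> \<in> J" for \<epsilon>
    using sets_eq_imp_space_eq[OF M[of \<epsilon>]] that by (simp add: J_def space_restrict_space)
  have coord: "(\<lambda>y. y \<epsilon>) \<in> borel_measurable (PiM J M)" if "\<epsilon> \<in> J" for \<epsilon>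
  proof -
    have "(\<lambda>y. y \<epsilon>) \<in> PiM J M \<rightarrow>\<^sub>M restrict_space borel {0..1 :: real}"
      using measurable_component_singleton[OF that, of M] M[of \<epsilon>] that
      by (simp add: J_def cong: measurable_cong_sets)
    then show ?thesis by (simp add: measurable_restrict_space2_iff)
  qed
  have mass: "(\<lambda>y. cell_mass y \<epsilon>) \<in> borel_measurable (PiM J M)" if "length \<epsilon> \<le> L" for \<epsilon>
    using that
  proof (induction \<epsilon> rule: rev_induct)
    case (snoc b \<epsilon>)
    then have [measurable]: "(\<lambda>y. cell_mass y \<epsilon>) \<in> borel_measurable (PiM J M)"
      "(\<lambda>y. y \<epsilon>) \<in> borel_measurable (PiM J M)"
      using coord[of \<epsilon>] by (auto simp: J_def)
    show ?case by (cases b) (simp_all add: cell_mass_snoc)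
  qed (simp add: cell_mass_def)
  have prob: "prob_space (tree_measure L y)" if y: "y \<in> space (PiM J M)" for y
  proof -
    have "y \<epsilon> \<in> {0..1}" if "length \<epsilon> < L" for \<epsilon>
      using sp[of \<epsilon>] that y by (auto simp: space_PiM J_def PiE_iff)
    from emeasure_tree_measure_dyadic[of L y "[]", OF this]
    have "emeasure (tree_measure L y) {0<..1} = 1"
      by (simp add: dyadic_Nil cell_mass_def)
    then show ?thesis
      by (intro prob_spaceI) (simp add: tree_measure_def unit_leb_def space_restrict_space)
  qed
  have "tree_measure L \<in> PiM J M \<rightarrow>\<^sub>M prob_algebra unit_leb"
  proof (rule measurable_prob_algebraI[OF prob])
    show "tree_measure L \<in> PiM J M \<rightarrow>\<^sub>M subprob_algebra unit_leb"
    proof (rule measurable_subprob_algebra)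
      fix y assume "y \<in> space (PiM J M)"
      then show "subprob_space (tree_measure L y)"
        by (intro prob_space_imp_subprob_space prob)
    next
      fix y show "sets (tree_measure L y) = sets unit_leb" by (simp add: tree_measure_def)
    next
      fix A assume A: "A \<in> sets unit_leb"
      show "(\<lambda>y. emeasure (tree_measure L y) A) \<in> borel_measurable (PiM J M)"
        unfolding emeasure_tree_measure[OF A]
      proof (intro borel_measurable_sum)
        fix \<epsilon> :: "bool list" assume "\<epsilon> \<in> {\<epsilon>. length \<epsilon> = L}"
        then have [measurable]: "(\<lambda>y. cell_mass y \<epsilon>) \<in> borel_measurable (PiM J M)"
          using mass by simp
        show "(\<lambda>y. ennreal (2 ^ L * cell_mass y \<epsilon>) * emeasure unit_leb (dyadic \<epsilon> \<inter> A))
            \<in> borel_measurable (PiM J M)"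
          by measurable
      qed
    qed
  qed
  then show ?thesis by (simp add: J_def)
qed

end

theory Submission
  imports Defs
begin

text \<open>
  The model is dominated: given the splitting variables \<open>y\<close>, the sample has a density with respect
  to Lebesgue measure on $(0,1]^n$, so the posterior is the prior law of \<open>y\<close> reweighted by the
  likelihood. The likelihood is a product over the words $\varepsilon$ with $|\varepsilon| < L$ of
  $(2 y_\varepsilon)^{N_X(I_{\varepsilon 0})} (2 (1 - y_\varepsilon))^{N_X(I_{\varepsilon 1})}$,
  so the coordinates stay independent and are updated one by one. This factor is 1 at the spike
  $y_\varepsilon = 1/2$, and it turns the slab $\mathrm{Beta}(\alpha_{\varepsilon 0},
  \alpha_{\varepsilon 1})$ into $T_X$ times the updated Beta law. Normalising the mixture
  $(1 - \pi_{\varepsilon 0}) \delta_{1/2} + \pi_{\varepsilon 0} T_X \mathrm{Beta}$ gives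
  $\tilde\pi_{\varepsilon 0}$.
\<close>

section \<open>Product measures: densities and measurability in the factor\<close>

text \<open>A product measure is determined by its values on boxes, and over a box the product
  density with the indicator of the box integrates factor by factor. Used twice in different roles:
  with observations as indices it gives the likelihood of a sample, with words as indices it keeps
  the splitting variables independent after reweighting.\<close>

lemma PiM_density:
  fixes M :: "'i \<Rightarrow> 'a measure"
  assumes I: "finite I"
    and M: "\<And>i. i \<in> I \<Longrightarrow> sigma_finite_measure (M i)"
    and f: "\<And>i. i \<in> I \<Longrightarrow> f i \<in> borel_measurable (M i)"
    and fM: "\<And>i. i \<in> I \<Longrightarrow> sigma_finite_measure (density (M i) (f i))"
  shows "PiM I (\<lambda>i. density (M i) (f i)) = density (PiM I M) (\<lambda>x. \<Prod>i\<in>I. f i (x i))"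
proof -
  \<comment> \<open>The locale \<open>product_sigma_finite\<close> asks for sigma-finiteness at
    every index, so both families are padded outside \<open>I\<close> by one-point spaces, which
    \<open>PiM I\<close> does not see.\<close>
  define M' where "M' i = (if i \<in> I then M i else count_space {undefined})" for i
  define N where "N i = (if i \<in> I then density (M i) (f i) else count_space {undefined})" for i
  interpret M: product_sigma_finite M'
    by (auto simp: product_sigma_finite_def M'_def M intro: sigma_finite_measure_count_space_finite)
  interpret N: product_sigma_finite N
    by (auto simp: product_sigma_finite_def N_def fM intro: sigma_finite_measure_count_space_finite)
  have [measurable]: "f i \<in> borel_measurable (M' i)" if "i \<in> I" for i
    using f[OF that] that by (simp add: M'_def)
  have PM: "PiM I M = PiM I M'"
    by (intro PiM_cong) (auto simp: M'_def)
  have "density (PiM I M') (\<lambda>x. \<Prod>i\<in>I. f i (x i)) = PiM I N"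
  proof (rule N.PiM_eqI[OF I])
    show "sets (density (PiM I M') (\<lambda>x. \<Prod>i\<in>I. f i (x i))) = sets (PiM I N)"
      unfolding sets_density by (intro sets_PiM_cong) (auto simp: M'_def N_def)
  next
    fix A assume "\<And>i. i \<in> I \<Longrightarrow> A i \<in> sets (N i)"
    then have A [measurable]: "A i \<in> sets (M' i)" if "i \<in> I" for i
      using that by (auto simp: N_def M'_def split: if_splits)
    have "emeasure (density (PiM I M') (\<lambda>x. \<Prod>i\<in>I. f i (x i))) (Pi\<^sub>E I A)
        = (\<integral>\<^sup>+x. (\<Prod>i\<in>I. f i (x i)) * indicator (Pi\<^sub>E I A) x \<partial>PiM I M')"
      using I A by (intro emeasure_density) (auto intro!: sets_PiM_I_finite)
    also have "\<dots> = (\<integral>\<^sup>+x. (\<Prod>i\<in>I. f i (x i) * indicator (A i) (x i)) \<partial>PiM I M')"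
    proof (intro nn_integral_cong)
      fix x assume "x \<in> space (PiM I M')"
      then have "indicator (Pi\<^sub>E I A) x = (\<Prod>i\<in>I. indicator (A i) (x i) :: ennreal)"
        using I by (cases "x \<in> Pi\<^sub>E I A") (auto simp: space_PiM PiE_iff indicator_def)
      then show "(\<Prod>i\<in>I. f i (x i)) * indicator (Pi\<^sub>E I A) x
          = (\<Prod>i\<in>I. f i (x i) * indicator (A i) (x i))"
        by (simp add: prod.distrib)
    qed
    also have "\<dots> = (\<Prod>i\<in>I. \<integral>\<^sup>+u. f i u * indicator (A i) u \<partial>M' i)"
      using I A by (intro M.product_nn_integral_prod) auto
    also have "\<dots> = (\<Prod>i\<in>I. emeasure (N i) (A i))"
    proof (intro prod.cong refl)
      fix i assume i: "i \<in> I"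
      show "(\<integral>\<^sup>+u. f i u * indicator (A i) u \<partial>M' i) = emeasure (N i) (A i)"
        using A[OF i] f[OF i] i by (simp add: N_def M'_def emeasure_density)
    qed
    finally show "emeasure (density (PiM I M') (\<lambda>x. \<Prod>i\<in>I. f i (x i))) (Pi\<^sub>E I A)
        = (\<Prod>i\<in>I. emeasure (N i) (A i))" .
  qed
  moreover have "PiM I N = PiM I (\<lambda>i. density (M i) (f i))"
    by (intro PiM_cong) (auto simp: N_def)
  ultimately show ?thesis by (simp add: PM)
qed

text \<open>Boxes form a generator closed under intersection, and the mass of a box is a finite
  product of evaluations \<open>emeasure P (E i)\<close>, each measurable in \<open>P\<close>. This
  makes i.i.d. sampling a kernel that \<open>joint_law\<close> can integrate against the
  prior.\<close>

lemma PiM_power_measurable: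
  assumes I: "finite I"
  shows "(\<lambda>P. PiM I (\<lambda>_. P)) \<in> prob_algebra M \<rightarrow>\<^sub>M prob_algebra (PiM I (\<lambda>_. M))"
proof (rule measurable_prob_algebra_generated[OF sets_PiM Int_stable_prod_algebra prod_algebra_sets_into_space])
  fix P assume "P \<in> space (prob_algebra M)"
  then have P: "prob_space P" "sets P = sets M" by (auto simp: space_prob_algebra)
  show "prob_space (PiM I (\<lambda>_. P))" using P by (intro prob_space_PiM)
  show "sets (PiM I (\<lambda>_. P)) = sets (PiM I (\<lambda>_. M))" using P by (intro sets_PiM_cong) auto
next
  fix C assume "C \<in> prod_algebra I (\<lambda>_. M)"
  then obtain E where E: "C = Pi\<^sub>E I E" "E \<in> (\<Pi> i\<in>I. sets M)" by (rule prod_algebraE_all)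
  have "emeasure (PiM I (\<lambda>_. P)) C = (\<Prod>i\<in>I. emeasure P (E i))"
    if "P \<in> space (prob_algebra M)" for P
  proof -
    have prob: "prob_space P" and sets: "sets P = sets M"
      using that by (auto simp: space_prob_algebra)
    from prob interpret product_prob_space "\<lambda>_. P" I
      by (simp add: product_prob_space_def product_prob_space_axioms_def product_sigma_finite_def
          prob_space_imp_sigma_finite)
    have "E i \<in> sets P" if "i \<in> I" for i using E(2) sets that by auto
    then show ?thesis unfolding E(1) by (intro emeasure_PiM I)
  qed
  moreover have "(\<lambda>P. \<Prod>i\<in>I. emeasure P (E i)) \<in> borel_measurable (prob_algebra M)"
    using E unfolding prob_algebra_def
    by (intro borel_measurable_prod_ennreal measurable_restrict_space1
        measurable_emeasure_subprob_algebra) auto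
  ultimately show "(\<lambda>P. emeasure (PiM I (\<lambda>_. P)) C) \<in> borel_measurable (prob_algebra M)"
    by (simp cong: measurable_cong)
qed

section \<open>Bayes' formula in a dominated model\<close>

lemma prob_space_unit_leb: "prob_space unit_leb"
  using emeasure_unit_leb_dyadic[of "[]"]
  by (intro prob_spaceI) (simp add: dyadic_Nil unit_leb_def space_restrict_space)

text \<open>
  Bayes' formula with parameter \<open>y\<close>, likelihood \<open>h\<close> and marginal likelihood \<open>m\<close>. Measurability
  of \<open>K\<close> comes from \<open>bayes\<close> by Fubini, after division by \<open>m\<close>.
\<close>

lemma is_posterior_dominated:
  fixes W :: "'y measure"
  assumes W: "prob_space W"
    and T [measurable]: "T \<in> W \<rightarrow>\<^sub>M prob_algebra unit_leb"
    and h [measurable]: "(\<lambda>(y, x). h y x) \<in> borel_measurable (W \<Otimes>\<^sub>M sample_space n)"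
    and lik: "\<And>y. y \<in> space W \<Longrightarrow> PiM {..<n} (\<lambda>_. T y) = density (sample_space n) (h y)"
    and K: "\<And>x. x \<in> space (sample_space n) \<Longrightarrow> K x \<in> space (prob_algebra (prob_algebra unit_leb))"
    and m: "\<And>x. x \<in> space (sample_space n) \<Longrightarrow> m x \<noteq> 0 \<and> m x \<noteq> \<top>"
    and bayes: "\<And>x A. x \<in> space (sample_space n) \<Longrightarrow> A \<in> sets (prob_algebra unit_leb) \<Longrightarrow>
      (\<integral>\<^sup>+y. h y x * indicator A (T y) \<partial>W) = m x * emeasure (K x) A"
  shows "is_posterior n (distr W (prob_algebra unit_leb) T) K"
proof -
  define R where "R = prob_algebra unit_leb"
  define X where "X = sample_space n"
  define J where "J = joint_law n (distr W R T)"
  note T' [measurable] = T[folded R_def] and h' [measurable] = h[folded X_def]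
  interpret W: prob_space W by (rule W)
  interpret X: prob_space X unfolding X_def by (intro prob_space_PiM prob_space_unit_leb)
  interpret WX: pair_sigma_finite W X ..
  have Kp: "prob_space (K x)" "sets (K x) = sets R" if "x \<in> space X" for x
    using K[of x] that by (auto simp: space_prob_algebra X_def R_def)
  have total: "emeasure (K x) (space R) = 1" if "x \<in> space X" for x
    using Kp[OF that] prob_space.emeasure_space_1[of "K x"] by (metis sets_eq_imp_space_eq)
  have bayes': "(\<integral>\<^sup>+y. h y x * indicator A (T y) \<partial>W) = m x * emeasure (K x) A"
    if "x \<in> space X" "A \<in> sets R" for x A
    using bayes that by (simp add: X_def R_def)

  have mK [measurable]: "(\<lambda>x. m x * emeasure (K x) A) \<in> borel_measurable X" if "A \<in> sets R" for A
  proof -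
    have [measurable]: "A \<in> sets R" by (fact that)
    have "(\<lambda>x. \<integral>\<^sup>+y. h y x * indicator A (T y) \<partial>W) \<in> borel_measurable X" by measurable
    then show ?thesis using bayes' that by (simp cong: measurable_cong)
  qed
  \<comment> \<open>Each \<open>K x\<close> has total mass 1, so \<open>mK\<close> for the whole
    space is a statement about \<open>m\<close> alone.\<close>
  have m_meas [measurable]: "m \<in> borel_measurable X"
    using mK[of "space R"] total by (simp cong: measurable_cong)
  have K_meas: "K \<in> X \<rightarrow>\<^sub>M prob_algebra R"
  proof (intro measurable_prob_algebraI measurable_subprob_algebra)
    fix A assume A: "A \<in> sets R"
    have "emeasure (K x) A = m x * emeasure (K x) A / m x" if "x \<in> space X" for x
      using m[of x] that by (simp add: X_def ennreal_mult_divide_eq mult.commute[of "m x"])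
    moreover have "(\<lambda>x. m x * emeasure (K x) A / m x) \<in> borel_measurable X"
      using A by measurable
    ultimately show "(\<lambda>x. emeasure (K x) A) \<in> borel_measurable X"
      by (simp cong: measurable_cong)
  qed (use Kp in \<open>auto intro: prob_space_imp_subprob_space\<close>)

  \<comment> \<open>Measurability of the kernel lets the bind over the prior be pulled back along
    \<open>T\<close> to an integral over the parameter \<open>y\<close>; Fubini then puts the sample
    on the outside, as in a disintegration.\<close>
  have kernel: "(\<lambda>P. distr (PiM {..<n} (\<lambda>_. P)) (R \<Otimes>\<^sub>M X) (\<lambda>x. (P, x))) \<in> R \<rightarrow>\<^sub>M subprob_algebra (R \<Otimes>\<^sub>M X)"
  proof (rule measurable_distr2[where M = X])
    show "(\<lambda>P. PiM {..<n} (\<lambda>_. P)) \<in> R \<rightarrow>\<^sub>M subprob_algebra X"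
      unfolding R_def X_def by (intro measurable_prob_algebraD PiM_power_measurable) simp
  qed simp
  have J: "emeasure J C = (\<integral>\<^sup>+x. \<integral>\<^sup>+y. h y x * indicator C (T y, x) \<partial>W \<partial>X)"
    if C [measurable]: "C \<in> sets (R \<Otimes>\<^sub>M X)" for C
  proof -
    have "emeasure J C = (\<integral>\<^sup>+y. emeasure (distr (PiM {..<n} (\<lambda>_. T y)) (R \<Otimes>\<^sub>M X) (\<lambda>x. (T y, x))) C \<partial>W)"
      unfolding J_def joint_law_def R_def[symmetric] X_def[symmetric]
      using W.not_empty kernel C
      by (subst bind_distr[OF T' kernel]) (auto intro!: emeasure_bind measurable_compose[OF T'])
    also have "\<dots> = (\<integral>\<^sup>+y. \<integral>\<^sup>+x. h y x * indicator C (T y, x) \<partial>X \<partial>W)"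
    proof (intro nn_integral_cong)
      fix y assume y [measurable]: "y \<in> space W"
      have Ty [measurable]: "T y \<in> space R" using measurable_space[OF T' y] .
      have "emeasure (distr (density X (h y)) (R \<Otimes>\<^sub>M X) (\<lambda>x. (T y, x))) C
          = (\<integral>\<^sup>+z. indicator C z \<partial>distr (density X (h y)) (R \<Otimes>\<^sub>M X) (\<lambda>x. (T y, x)))"
        by simp
      also have "\<dots> = (\<integral>\<^sup>+x. indicator C (T y, x) \<partial>density X (h y))"
        by (rule nn_integral_distr) measurable
      also have "\<dots> = (\<integral>\<^sup>+x. h y x * indicator C (T y, x) \<partial>X)"
        by (rule nn_integral_density) measurable
      finally show "emeasure (distr (PiM {..<n} (\<lambda>_. T y)) (R \<Otimes>\<^sub>M X) (\<lambda>x. (T y, x))) C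
          = (\<integral>\<^sup>+x. h y x * indicator C (T y, x) \<partial>X)"
        using lik[OF y] by (simp add: X_def)
    qed
    also have "\<dots> = (\<integral>\<^sup>+x. \<integral>\<^sup>+y. h y x * indicator C (T y, x) \<partial>W \<partial>X)"
      by (rule WX.Fubini'[symmetric]) measurable
    finally show ?thesis .
  qed
  have J_rect: "emeasure J (A \<times> B) = (\<integral>\<^sup>+x. m x * emeasure (K x) A * indicator B x \<partial>X)"
    if A [measurable]: "A \<in> sets R" and B [measurable]: "B \<in> sets X" for A B
  proof -
    have "emeasure J (A \<times> B) = (\<integral>\<^sup>+x. \<integral>\<^sup>+y. h y x * indicator (A \<times> B) (T y, x) \<partial>W \<partial>X)"
      by (rule J) measurable
    also have "\<dots> = (\<integral>\<^sup>+x. m x * emeasure (K x) A * indicator B x \<partial>X)"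
    proof (intro nn_integral_cong)
      fix x assume x [measurable]: "x \<in> space X"
      have "(\<integral>\<^sup>+y. h y x * indicator (A \<times> B) (T y, x) \<partial>W)
          = (\<integral>\<^sup>+y. h y x * indicator A (T y) * indicator B x \<partial>W)"
        by (simp add: indicator_times mult.assoc)
      also have "\<dots> = m x * emeasure (K x) A * indicator B x"
        using bayes'[OF x A] by (subst nn_integral_multc) simp_all
      finally show "(\<integral>\<^sup>+y. h y x * indicator (A \<times> B) (T y, x) \<partial>W)
          = m x * emeasure (K x) A * indicator B x" .
    qed
    finally show ?thesis .
  qed
  have setsJ: "sets J = sets (R \<Otimes>\<^sub>M X)"
    unfolding J_def joint_law_def R_def[symmetric] X_def[symmetric]
    using W.not_empty measurable_space[OF T']
    by (subst sets_bind[where N = "R \<Otimes>\<^sub>M X"]) auto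
  \<comment> \<open>The case of \<open>J_rect\<close> where \<open>A\<close> is the whole space:
    \<open>m\<close> is the marginal density of the sample. Hence the factor \<open>m x\<close> in
    \<open>J_rect\<close> is exactly integration against the marginal law, as the definition of a
    posterior demands.\<close>
  have marginal: "distr J X snd = density X m"
  proof (rule measure_eqI)
    fix B assume "B \<in> sets (distr J X snd)"
    then have B [measurable]: "B \<in> sets X" by simp
    have "emeasure (distr J X snd) B = emeasure J (snd -` B \<inter> space J)"
      by (intro emeasure_distr) (simp_all add: setsJ cong: measurable_cong_sets)
    also have "snd -` B \<inter> space J = space R \<times> B"
      using sets_eq_imp_space_eq[OF setsJ] sets.sets_into_space[OF B]
      by (auto simp: space_pair_measure)
    also have "emeasure J (space R \<times> B) = (\<integral>\<^sup>+x. m x * indicator B x \<partial>X)"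
      by (subst J_rect) (auto simp: total intro!: nn_integral_cong)
    also have "\<dots> = emeasure (density X m) B"
      by (rule emeasure_density[symmetric]) measurable
    finally show "emeasure (distr J X snd) B = emeasure (density X m) B" .
  qed simp
  have "emeasure J (A \<times> B) = (\<integral>\<^sup>+x\<in>B. emeasure (K x) A \<partial>distr J X snd)"
    if A [measurable]: "A \<in> sets R" and B [measurable]: "B \<in> sets X" for A B
  proof -
    have [measurable]: "(\<lambda>x. emeasure (K x) A) \<in> borel_measurable X"
      using measurable_emeasure_kernel[OF measurable_prob_algebraD[OF K_meas] A] .
    show ?thesis
      unfolding marginal by (subst nn_integral_density) (auto simp: J_rect[OF A B] mult.assoc)
  qed
  then show ?thesis
    using K_meas by (simp add: is_posterior_def J_def R_def X_def)
qed

section \<open>Conjugate update of one spike and slab variable\<close>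

lemma prob_space_spike_slab:
  assumes "0 < a" "0 < b" "p \<in> {0..1}"
  shows "prob_space (spike_slab p a b)"
proof
  have sp: "space (spike_slab p a b) = {0..1}" "space (beta_measure a b) = {0..1}"
    using sets_eq_imp_space_eq[OF sets_spike_slab[of p a b]]
    by (simp_all add: space_restrict_space beta_measure_def)
  have "emeasure (beta_measure a b) {0..1} = 1"
    using prob_space.emeasure_space_1[OF prob_space_beta_measure[OF assms(1,2)]] sp by simp
  then show "emeasure (spike_slab p a b) (space (spike_slab p a b)) = 1"
    using assms unfolding sp
    by (subst emeasure_spike_slab) (auto simp: sets_restrict_space simp flip: ennreal_plus)
qed

lemma nn_integral_spike_slab:
  assumes "0 < a" "0 < b" "p \<in> {0..1}"
    and f [measurable]: "f \<in> borel_measurable (restrict_space borel {0..1})"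
  shows "(\<integral>\<^sup>+u. f u \<partial>spike_slab p a b) =
    ennreal (1 - p) * f (1/2) + ennreal p * (\<integral>\<^sup>+u. f u \<partial>beta_measure a b)"
proof -
  let ?R = "restrict_space borel {0..1 :: real}"
  have sets: "sets (beta_measure a b) = sets ?R"
    by (simp add: beta_measure_def sets_restrict_space)
  interpret prob_space "beta_measure a b" using assms prob_space_beta_measure by blast
  have "beta_measure a b \<in> space (subprob_algebra ?R)"
    by (simp add: space_subprob_algebra sets subprob_space_axioms)
  moreover have "return ?R (1/2) \<in> space (subprob_algebra ?R)"
    by (auto simp: space_subprob_algebra space_restrict_space
        intro!: prob_space_imp_subprob_space prob_space_return)
  ultimately have "(\<integral>\<^sup>+u. f u \<partial>spike_slab p a b) = (\<integral>\<^sup>+slab. \<integral>\<^sup>+u. f u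
      \<partial>(if slab then beta_measure a b else return ?R (1/2)) \<partial>measure_pmf (bernoulli_pmf p))"
    unfolding spike_slab_def by (intro nn_integral_bind[where B = ?R]) auto
  then show ?thesis
    using assms
    by (simp add: nn_integral_bernoulli_pmf nn_integral_return space_restrict_space
        mult.commute add.commute)
qed

text \<open>Here \<open>j\<close> and \<open>k\<close> stand for the numbers of observations in the
  left and right child of a cell. The constant \<open>c\<close> is the total mass after reweighting,
  that is, the marginal likelihood at this word. Keeping it as a constant density on the right,
  instead of dividing by it, gives a form that can be multiplied over all words by
  \<open>PiM_density\<close>.\<close>

lemma spike_slab_conjugate:
  fixes a b j k :: nat and p :: real
  assumes ab: "0 < a" "0 < b" and p: "p \<in> {0..1}"
  defines "T \<equiv> 2 ^ (j + k) * (Beta (real (j + a)) (real (k + b)) / Beta (real a) (real b))"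
  defines "c \<equiv> (1 - p) + p * T"
  shows "density (spike_slab p a b) (\<lambda>u. ennreal ((2 * u) ^ j * (2 * (1 - u)) ^ k)) =
    density (spike_slab (p * T / c) (j + a) (k + b)) (\<lambda>_. ennreal c)"
    and "0 < c" and "p * T / c \<in> {0..1}"
proof -
  let ?R = "restrict_space borel {0..1 :: real}"
  have B: "Beta (real a) (real b) > 0" "Beta (real (j + a)) (real (k + b)) > 0"
    using ab by (simp_all add: Beta_def)
  have T: "0 < T" using B by (simp add: T_def)
  then have pT: "0 \<le> p * T" using p by simp
  show c: "0 < c"
  proof (cases "p = 0")
    case False
    then have "0 < p * T" using p T by simp
    then show ?thesis using p by (simp add: c_def)
  qed (simp add: c_def)
  then show p': "p * T / c \<in> {0..1}" using p pT by (simp add: c_def)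
  have beta: "(2 * u) ^ j * (2 * (1 - u)) ^ k *
      (u powr (real a - 1) * (1 - u) powr (real b - 1) / Beta a b) =
      T * (u powr (real (j + a) - 1) * (1 - u) powr (real (k + b) - 1) / Beta (real (j + a)) (real (k + b)))"
    if "u \<in> {0..1}" for u :: real
  proof -
    \<comment> \<open>At \<open>v = 0\<close> both sides vanish because \<open>0 powr s = 0\<close>
      for every \<open>s\<close>, including \<open>s = 0\<close>; so the endpoints of the unit
      interval need no exception.\<close>
    have pw: "v ^ i * v powr (real d - 1) = v powr (real (i + d) - 1)" if "0 \<le> v" for v :: real and i d
      using that by (cases "v = 0") (auto simp: powr_add[symmetric] powr_realpow[symmetric] algebra_simps)
    have "(2 * u) ^ j * (2 * v) ^ k * (u powr (real a - 1) * v powr (real b - 1) / Beta a b) =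
      2 ^ (j + k) * (u ^ j * u powr (real a - 1)) * (v ^ k * v powr (real b - 1)) / Beta a b" for v
      by (simp add: power_mult_distrib power_add)
    from this[of "1 - u"] show ?thesis using that B(2) by (simp only: pw) (simp add: pw T_def field_simps)
  qed
  have int: "(\<integral>\<^sup>+u. ennreal ((2 * u) ^ j * (2 * (1 - u)) ^ k) * f u \<partial>beta_measure a b) =
      ennreal T * (\<integral>\<^sup>+u. f u \<partial>beta_measure (real (j + a)) (real (k + b)))"
    if f: "f \<in> borel_measurable ?R" for f
  proof -
    have [measurable]: "f \<in> borel_measurable (restrict_space lborel {0..1})"
      using f by (simp add: sets_restrict_space cong: measurable_cong_sets)
    have [measurable]: "(\<lambda>u. u) \<in> borel_measurable (restrict_space lborel {0..1 :: real})"
      by (simp add: measurable_restrict_space1)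
    let ?L = "restrict_space lborel {0..1 :: real}"
    let ?d = "\<lambda>a b u. ennreal (u powr (a - 1) * (1 - u) powr (b - 1) / Beta a b)"
    have "(\<integral>\<^sup>+u. ennreal ((2 * u) ^ j * (2 * (1 - u)) ^ k) * f u \<partial>beta_measure a b) =
        (\<integral>\<^sup>+u. ?d (real a) (real b) u * (ennreal ((2 * u) ^ j * (2 * (1 - u)) ^ k) * f u) \<partial>?L)"
      unfolding beta_measure_def by (subst nn_integral_density) auto
    also have "\<dots> = (\<integral>\<^sup>+u. ennreal T * (?d (real (j + a)) (real (k + b)) u * f u) \<partial>?L)"
    proof (intro nn_integral_cong)
      fix u assume "u \<in> space ?L"
      then have u: "u \<in> {0..1}" by (simp add: space_restrict_space)
      have "?d (real a) (real b) u * ennreal ((2 * u) ^ j * (2 * (1 - u)) ^ k)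
          = ennreal ((2 * u) ^ j * (2 * (1 - u)) ^ k *
      (u powr (real a - 1) * (1 - u) powr (real b - 1) / Beta a b))"
        using u B by (subst ennreal_mult[symmetric]) (auto simp: mult_ac)
      also have "\<dots> = ennreal T * ?d (real (j + a)) (real (k + b)) u"
        unfolding beta[OF u] using u B T by (subst ennreal_mult) auto
      finally show "?d (real a) (real b) u * (ennreal ((2 * u) ^ j * (2 * (1 - u)) ^ k) * f u)
          = ennreal T * (?d (real (j + a)) (real (k + b)) u * f u)"
        by (simp only: mult.assoc[symmetric])
    qed
    also have "\<dots> = ennreal T * (\<integral>\<^sup>+u. f u \<partial>beta_measure (real (j + a)) (real (k + b)))"
      unfolding beta_measure_def by (subst nn_integral_cmult) (auto simp: nn_integral_density)
    finally show ?thesis .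
  qed
  show "density (spike_slab p a b) (\<lambda>u. ennreal ((2 * u) ^ j * (2 * (1 - u)) ^ k)) =
    density (spike_slab (p * T / c) (j + a) (k + b)) (\<lambda>_. ennreal c)" (is "density _ ?g = _")
  proof (rule measure_eqI)
    fix A assume "A \<in> sets (density (spike_slab p a b) ?g)"
    then have A [measurable]: "A \<in> sets ?R" by (simp add: sets_spike_slab)
    have [measurable]: "(\<lambda>u. u) \<in> borel_measurable ?R"
      by (simp add: measurable_restrict_space1)
    \<comment> \<open>The spike has likelihood 1, so only the slab part is reweighted.\<close>
    have half: "?g (1/2) = 1" by simp
    have "emeasure (density (spike_slab p a b) ?g) A = (\<integral>\<^sup>+u. ?g u * indicator A u \<partial>spike_slab p a b)"
      by (intro emeasure_density) (simp_all add: sets_spike_slab cong: measurable_cong_sets)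
    also have "\<dots> = ennreal (1 - p) * indicator A (1/2) +
        ennreal p * (ennreal T * emeasure (beta_measure (real (j + a)) (real (k + b))) A)"
    proof (subst nn_integral_spike_slab)
      have "(\<integral>\<^sup>+u. ?g u * indicator A u \<partial>beta_measure a b) =
          ennreal T * emeasure (beta_measure (real (j + a)) (real (k + b))) A"
        using A by (subst int) (auto simp: beta_measure_def sets_restrict_space)
      then show "ennreal (1 - p) * (?g (1/2) * indicator A (1/2)) +
          ennreal p * (\<integral>\<^sup>+u. ?g u * indicator A u \<partial>beta_measure a b) =
          ennreal (1 - p) * indicator A (1/2) +
          ennreal p * (ennreal T * emeasure (beta_measure (real (j + a)) (real (k + b))) A)"
        unfolding half by simp
    qed (use ab p in auto)
    also have "\<dots> = ennreal c * emeasure (spike_slab (p * T / c) (j + a) (k + b)) A"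
    proof -
      \<comment> \<open>The reweighted mixture has masses \<open>1 - p\<close> on the spike and
        \<open>p * T\<close> on the slab; dividing both by their sum \<open>c\<close> yields the new
        weights.\<close>
      have "1 - p = c * (1 - p * T / c)" using c by (simp add: c_def field_simps)
      then have 1: "ennreal (1 - p) = ennreal c * ennreal (1 - p * T / c)"
        using c p' by (subst ennreal_mult[symmetric]) auto
      have 2: "ennreal p * ennreal T = ennreal c * ennreal (p * T / c)"
        using c p p' T by (subst (1 2) ennreal_mult[symmetric]) auto
      show ?thesis
        using ab p' by (subst emeasure_spike_slab) (auto simp: 1 2 distrib_left simp flip: mult.assoc)
    qed
    also have "\<dots> = emeasure (density (spike_slab (p * T / c) (j + a) (k + b)) (\<lambda>_. ennreal c)) A"
      by (subst emeasure_density_const) (simp_all add: sets_spike_slab)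
    finally show "emeasure (density (spike_slab p a b) ?g) A =
        emeasure (density (spike_slab (p * T / c) (j + a) (k + b)) (\<lambda>_. ennreal c)) A" .
  qed (simp add: sets_spike_slab)
qed

section \<open>Factorisation of the likelihood over the words\<close>

text \<open>
  The density of \<open>P\<close> at \<open>t\<close> telescopes along the path of words whose cells contain \<open>t\<close>; this
  is the factor $2 P(I_{\varepsilon b}) / P(I_\varepsilon)$ contributed by \<open>\<epsilon>\<close>, and 1 for
  the words off the path.
\<close>

definition split_density :: "bool list \<Rightarrow> real \<Rightarrow> real \<Rightarrow> real" where
  "split_density \<epsilon> u t =
     (if t \<in> dyadic (\<epsilon> @ [False]) then 2 * u else if t \<in> dyadic (\<epsilon> @ [True]) then 2 * (1 - u) else 1)"

lemma split_density_nonneg: "u \<in> {0..1} \<Longrightarrow> 0 \<le> split_density \<epsilon> u t"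
  by (simp add: split_density_def)

lemma measurable_split_density [measurable]:
  assumes [measurable]: "f \<in> borel_measurable M" "g \<in> M \<rightarrow>\<^sub>M unit_leb"
  shows "(\<lambda>z. split_density \<epsilon> (f z) (g z)) \<in> borel_measurable M"
  unfolding split_density_def by measurable

lemma finite_words_less: "finite {\<epsilon> :: bool list. length \<epsilon> < L}"
proof -
  have "{\<epsilon> :: bool list. length \<epsilon> < L} = (\<Union>l<L. {\<epsilon>. length \<epsilon> = l})" by auto
  then show ?thesis by (simp add: finite_words)
qed

lemma ex_word_dyadic: "t \<in> {0<..1} \<Longrightarrow> \<exists>\<delta>. length \<delta> = L \<and> t \<in> dyadic \<delta>"
proof (induction L)
  case 0
  then show ?case by (intro exI[of _ "[]"]) (simp add: dyadic_Nil)
next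
  case (Suc L)
  then obtain \<delta> where \<delta>: "length \<delta> = L" "t \<in> dyadic \<delta>" by blast
  then obtain b where "t \<in> dyadic (\<delta> @ [b])" using dyadic_split(1)[of \<delta>] by blast
  with \<delta> show ?case by (intro exI[of _ "\<delta> @ [b]"]) simp
qed

text \<open>Going down one level multiplies the cell mass by one splitting variable or its
  complement and halves the cell length, which accounts for the factor 2 in
  \<open>split_density\<close>.\<close>

lemma cell_mass_eq_prod_split_density:
  "t \<in> dyadic \<delta> \<Longrightarrow>
    2 ^ length \<delta> * cell_mass y \<delta> = (\<Prod>\<epsilon> | length \<epsilon> < length \<delta>. split_density \<epsilon> (y \<epsilon>) t)"
proof (induction \<delta> rule: rev_induct)
  case Nil
  show ?case by (simp add: cell_mass_def)
next
  case (snoc b \<delta>)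
  have sub: "dyadic (\<epsilon> @ [c]) \<subseteq> dyadic \<epsilon>" for \<epsilon> c
    using dyadic_split(1)[of \<epsilon>] by (cases c) auto
  have t: "t \<in> dyadic \<delta>" using snoc.prems sub by blast
  \<comment> \<open>Among the words of the level being added, only \<open>\<delta>\<close> has a
    cell containing \<open>t\<close>, so the product over that level has a single nontrivial
    factor.\<close>
  have "split_density \<epsilon> (y \<epsilon>) t = 1" if "length \<epsilon> = length \<delta>" "\<epsilon> \<noteq> \<delta>" for \<epsilon>
    using dyadic_disjoint[OF that] t sub[of \<epsilon>] by (auto simp: split_density_def)
  then have "(\<Prod>\<epsilon> | length \<epsilon> = length \<delta>. split_density \<epsilon> (y \<epsilon>) t) = split_density \<delta> (y \<delta>) t"
    by (subst prod.remove[of _ \<delta>]) (auto simp: finite_words intro!: prod.neutral)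
  moreover have "split_density \<delta> (y \<delta>) t = 2 * (if b then 1 - y \<delta> else y \<delta>)"
    using snoc.prems dyadic_split(2)[of \<delta>] by (cases b) (auto simp: split_density_def)
  moreover have "{\<epsilon> :: bool list. length \<epsilon> < length (\<delta> @ [b])} =
      {\<epsilon>. length \<epsilon> < length \<delta>} \<union> {\<epsilon>. length \<epsilon> = length \<delta>}"
    by auto
  then have "(\<Prod>\<epsilon> | length \<epsilon> < length (\<delta> @ [b]). split_density \<epsilon> (y \<epsilon>) t) =
      (\<Prod>\<epsilon> | length \<epsilon> < length \<delta>. split_density \<epsilon> (y \<epsilon>) t) *
      (\<Prod>\<epsilon> | length \<epsilon> = length \<delta>. split_density \<epsilon> (y \<epsilon>) t)"
    by (simp only:) (intro prod.union_disjoint, auto simp: finite_words finite_words_less)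
  ultimately show ?case using snoc.IH[OF t] by (simp add: cell_mass_snoc mult_ac)
qed

text \<open>Exactly one cell of level \<open>L\<close> contains a given point, so the sum of
  indicators has one nonzero term. The gain is a product whose index set is the same for all points,
  so that products over observations and over words can be interchanged.\<close>

lemma tree_measure_eq_density:
  "tree_measure L y = density unit_leb (\<lambda>t. ennreal (\<Prod>\<epsilon> | length \<epsilon> < L. split_density \<epsilon> (y \<epsilon>) t))"
  unfolding tree_measure_def
proof (rule density_cong)
  show "AE t in unit_leb.
      (\<Sum>\<epsilon> | length \<epsilon> = L. ennreal (2 ^ L * cell_mass y \<epsilon>) * indicator (dyadic \<epsilon>) t) =
      ennreal (\<Prod>\<epsilon> | length \<epsilon> < L. split_density \<epsilon> (y \<epsilon>) t)"
  proof (rule AE_I2)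
    fix t assume "t \<in> space unit_leb"
    then obtain \<delta> where \<delta>: "length \<delta> = L" "t \<in> dyadic \<delta>"
      using ex_word_dyadic[of t L] by (auto simp: unit_leb_def space_restrict_space)
    have "indicator (dyadic \<epsilon>) t = (0 :: ennreal)" if "length \<epsilon> = L" "\<epsilon> \<noteq> \<delta>" for \<epsilon>
      using dyadic_disjoint[of \<epsilon> \<delta>] that \<delta> by (auto simp: indicator_def)
    then have "(\<Sum>\<epsilon> | length \<epsilon> = L. ennreal (2 ^ L * cell_mass y \<epsilon>) * indicator (dyadic \<epsilon>) t) =
        ennreal (2 ^ L * cell_mass y \<delta>)"
      using \<delta> finite_words[of L] by (subst sum.remove[of _ \<delta>]) (auto intro!: sum.neutral)
    then show "(\<Sum>\<epsilon> | length \<epsilon> = L. ennreal (2 ^ L * cell_mass y \<epsilon>) * indicator (dyadic \<epsilon>) t) =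
        ennreal (\<Prod>\<epsilon> | length \<epsilon> < L. split_density \<epsilon> (y \<epsilon>) t)"
      using cell_mass_eq_prod_split_density[OF \<delta>(2), of y] \<delta>(1) by simp
  qed
qed measurable

lemma prod_split_density:
  "(\<Prod>i<n. split_density \<epsilon> u (x i)) =
    (2 * u) ^ cell_count n x (\<epsilon> @ [False]) * (2 * (1 - u)) ^ cell_count n x (\<epsilon> @ [True])"
proof -
  \<comment> \<open>With indicators as exponents, multiplying over the observations adds them up to
    the cell counts. The convention \<open>0 ^ 0 = 1\<close> makes this correct at
    \<open>u = 0\<close> and \<open>u = 1\<close> too.\<close>
  have "split_density \<epsilon> u t = (2 * u) ^ indicator (dyadic (\<epsilon> @ [False])) t *
      (2 * (1 - u)) ^ indicator (dyadic (\<epsilon> @ [True])) t" for t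
    using dyadic_split(2)[of \<epsilon>] by (auto simp: split_density_def indicator_def)
  then show ?thesis by (simp only: cell_count_def power_sum prod.distrib)
qed

text \<open>Matches the power of 2 in \<open>T_stat\<close>, whose exponent is the count of the
  parent cell, with the exponent \<open>j + k\<close> produced by
  \<open>spike_slab_conjugate\<close>.\<close>

lemma cell_count_split:
  "cell_count n x \<epsilon> = cell_count n x (\<epsilon> @ [False]) + cell_count n x (\<epsilon> @ [True])"
  unfolding cell_count_def sum.distrib[symmetric] dyadic_split(1)[of \<epsilon>]
  using dyadic_split(2)[of \<epsilon>] by (intro sum.cong) (auto simp: indicator_def)

section \<open>The posterior of the tree\<close>

theorem theorem1:
  fixes n L :: nat
    and \<pi> :: "bool list \<Rightarrow> real"
    and \<alpha> :: "bool list \<Rightarrow> nat"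
  assumes n: "n \<ge> 1"
    and L: "2 ^ L * L\<^sup>2 \<le> n" "\<And>l::nat. 2 ^ l * l\<^sup>2 \<le> n \<Longrightarrow> l \<le> L"
    and \<pi>: "\<And>\<epsilon>. length \<epsilon> < L \<Longrightarrow> 0 < \<pi> \<epsilon> \<and> \<pi> \<epsilon> \<le> 1"
    and \<alpha>: "\<And>\<epsilon>. 1 \<le> length \<epsilon> \<Longrightarrow> length \<epsilon> \<le> L \<Longrightarrow> 0 < \<alpha> \<epsilon>"
  shows "is_posterior n (sspt L \<pi> \<alpha>) (\<lambda>x. sspt L (post_p n x \<pi> \<alpha>) (post_a n x \<alpha>)) \<and>
    (\<forall>x \<in> space (sample_space n). sspt_params L (post_p n x \<pi> \<alpha>) (post_a n x \<alpha>))"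
proof -
  define J where "J = {\<epsilon> :: bool list. length \<epsilon> < L}"
  have J: "finite J" by (simp add: J_def finite_words_less)
  define S where "S \<epsilon> = spike_slab (\<pi> \<epsilon>) (\<alpha> (\<epsilon> @ [False])) (\<alpha> (\<epsilon> @ [True]))" for \<epsilon>
  define S' where "S' x \<epsilon> = spike_slab (post_p n x \<pi> \<alpha> \<epsilon>)
      (post_a n x \<alpha> (\<epsilon> @ [False])) (post_a n x \<alpha> (\<epsilon> @ [True]))" for x \<epsilon>
  define c where "c x \<epsilon> = (1 - \<pi> \<epsilon>) + \<pi> \<epsilon> * T_stat n x \<alpha> \<epsilon>" for x \<epsilon>
  define g where "g x \<epsilon> u = ennreal ((2 * u) ^ cell_count n x (\<epsilon> @ [False]) *
      (2 * (1 - u)) ^ cell_count n x (\<epsilon> @ [True]))" for x \<epsilon> u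
  define h where "h y x = (\<Prod>i<n. ennreal (\<Prod>\<epsilon>\<in>J. split_density \<epsilon> (y \<epsilon>) (x i)))"
    for y :: "bool list \<Rightarrow> real" and x :: "nat \<Rightarrow> real"
  define R where "R = prob_algebra unit_leb"
  have \<alpha>J: "0 < \<alpha> (\<epsilon> @ [b])" if "\<epsilon> \<in> J" for \<epsilon> b
    using that by (intro \<alpha>) (auto simp: J_def)
  have \<pi>J: "\<pi> \<epsilon> \<in> {0..1}" if "\<epsilon> \<in> J" for \<epsilon>
    using \<pi>[of \<epsilon>] that by (simp add: J_def)
  have conj: "density (S \<epsilon>) (g x \<epsilon>) = density (S' x \<epsilon>) (\<lambda>_. ennreal (c x \<epsilon>))"
      "0 < c x \<epsilon>" "post_p n x \<pi> \<alpha> \<epsilon> \<in> {0..1}" if "\<epsilon> \<in> J" for x \<epsilon>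
    using spike_slab_conjugate[OF \<alpha>J[OF that, of False] \<alpha>J[OF that, of True] \<pi>J[OF that],
        of "cell_count n x (\<epsilon> @ [False])" "cell_count n x (\<epsilon> @ [True])"]
    unfolding S_def S'_def g_def c_def post_p_def T_stat_def post_a_def
      cell_count_split[of n x \<epsilon>] by simp_all
  have a': "0 < post_a n x \<alpha> (\<epsilon> @ [b])" if "\<epsilon> \<in> J" for x \<epsilon> b
    using \<alpha>J[OF that] by (simp add: post_a_def)
  have S: "prob_space (S \<epsilon>)" if "\<epsilon> \<in> J" for \<epsilon>
    unfolding S_def using \<alpha>J \<pi>J that by (intro prob_space_spike_slab) auto
  have S': "prob_space (S' x \<epsilon>)" if "\<epsilon> \<in> J" for x \<epsilon>
    unfolding S'_def using a' conj(3) that by (intro prob_space_spike_slab) auto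
  have setsS: "sets (S \<epsilon>) = sets (restrict_space borel {0..1})"
      "sets (S' x \<epsilon>) = sets (restrict_space borel {0..1})" for x \<epsilon>
    by (simp_all add: S_def S'_def sets_spike_slab)
  have sp: "space (S \<epsilon>) = {0..1}" for \<epsilon>
    using sets_eq_imp_space_eq[OF setsS(1)] by (simp add: space_restrict_space)
  have T: "tree_measure L \<in> PiM J S \<rightarrow>\<^sub>M R" "tree_measure L \<in> PiM J (S' x) \<rightarrow>\<^sub>M R" for x
    unfolding J_def R_def by (intro tree_measure_measurable setsS)+
  have borelS: "f \<in> borel_measurable (S \<epsilon>)" if "f \<in> borel_measurable borel"
    for f :: "real \<Rightarrow> 'b :: topological_space" and \<epsilon>
    using that setsS(1)[of \<epsilon>] by (simp add: measurable_restrict_space1 cong: measurable_cong_sets)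
  have g_meas: "g x \<epsilon> \<in> borel_measurable (S \<epsilon>)" for x \<epsilon>
    unfolding g_def by (intro borelS) measurable
  have coord: "y \<epsilon> \<in> {0..1}" if "y \<in> space (PiM J S)" "\<epsilon> \<in> J" for y \<epsilon>
    using that sp by (auto simp: space_PiM PiE_iff)

  \<comment> \<open>The weight is a product of functions of single coordinates, so reweighting the
    product law means reweighting each factor; \<open>conj\<close> then replaces each factor by its
    updated law times a constant.\<close>
  have update: "density (PiM J S) (\<lambda>y. \<Prod>\<epsilon>\<in>J. g x \<epsilon> (y \<epsilon>)) =
      density (PiM J (S' x)) (\<lambda>_. \<Prod>\<epsilon>\<in>J. ennreal (c x \<epsilon>))" for x
  proof -
    have fin: "sigma_finite_measure (density (S' x \<epsilon>) (\<lambda>_. ennreal (c x \<epsilon>)))" if "\<epsilon> \<in> J" for \<epsilon>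
    proof -
      interpret prob_space "S' x \<epsilon>" using S'[OF that] .
      have "finite_measure (density (S' x \<epsilon>) (\<lambda>_. ennreal (c x \<epsilon>)))"
        by (intro finite_measureI) (simp add: emeasure_density_const emeasure_space_1)
      then show ?thesis by (simp add: finite_measure_def)
    qed
    have "density (PiM J S) (\<lambda>y. \<Prod>\<epsilon>\<in>J. g x \<epsilon> (y \<epsilon>)) = PiM J (\<lambda>\<epsilon>. density (S \<epsilon>) (g x \<epsilon>))"
      using J S g_meas fin conj(1)
      by (intro PiM_density[symmetric]) (auto simp: prob_space_imp_sigma_finite)
    also have "\<dots> = PiM J (\<lambda>\<epsilon>. density (S' x \<epsilon>) (\<lambda>_. ennreal (c x \<epsilon>)))"
      by (intro PiM_cong conj(1)) auto
    also have "\<dots> = density (PiM J (S' x)) (\<lambda>_. \<Prod>\<epsilon>\<in>J. ennreal (c x \<epsilon>))"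
      using J S' fin by (intro PiM_density) (auto simp: prob_space_imp_sigma_finite)
    finally show ?thesis .
  qed

  have "is_posterior n (distr (PiM J S) (prob_algebra unit_leb) (tree_measure L))
      (\<lambda>x. distr (PiM J (S' x)) (prob_algebra unit_leb) (tree_measure L))"
  \<comment> \<open>The marginal likelihood \<open>m\<close> is the product over all words of their
    normalising constants; it is nonzero and finite since each of the finitely many
    \<open>c x \<epsilon>\<close> is positive and real.\<close>
  proof (rule is_posterior_dominated[where h = h and m = "\<lambda>x. \<Prod>\<epsilon>\<in>J. ennreal (c x \<epsilon>)"])
    show "prob_space (PiM J S)" by (intro prob_space_PiM S)
    show "tree_measure L \<in> PiM J S \<rightarrow>\<^sub>M prob_algebra unit_leb" using T by (simp add: R_def)
  next
    have [measurable]: "(\<lambda>z. fst z \<epsilon>) \<in> borel_measurable (PiM J S \<Otimes>\<^sub>M sample_space n)" if "\<epsilon> \<in> J" for \<epsilon>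
      using measurable_compose[OF measurable_fst measurable_compose[OF
        measurable_component_singleton[OF that] borelS[of "\<lambda>u. u"]]] by simp
    show "(\<lambda>(y, x). h y x) \<in> borel_measurable (PiM J S \<Otimes>\<^sub>M sample_space n)"
      unfolding h_def split_beta' by measurable
  next
    fix y assume y: "y \<in> space (PiM J S)"
    \<comment> \<open>Supplies the sigma-finiteness of the weighted factors that
      \<open>PiM_density\<close> asks for.\<close>
    have "prob_space (tree_measure L y)"
      using measurable_space[OF T(1) y] by (simp add: R_def space_prob_algebra)
    then show "PiM {..<n} (\<lambda>_. tree_measure L y) = density (sample_space n) (h y)"
      unfolding tree_measure_eq_density h_def J_def
      by (intro PiM_density) (auto intro: prob_space_imp_sigma_finite prob_space_unit_leb)
  next
    fix x
    show "distr (PiM J (S' x)) (prob_algebra unit_leb) (tree_measure L)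
        \<in> space (prob_algebra (prob_algebra unit_leb))"
      using T(2)[of x] S'
      by (auto simp: space_prob_algebra[of "prob_algebra unit_leb"] R_def
          intro!: prob_space.prob_space_distr prob_space_PiM)
    have "ennreal (c x \<epsilon>) \<noteq> 0" if "\<epsilon> \<in> J" for \<epsilon>
      using conj(2)[OF that, of x] by (simp add: ennreal_eq_0_iff not_le)
    then show "(\<Prod>\<epsilon>\<in>J. ennreal (c x \<epsilon>)) \<noteq> 0 \<and> (\<Prod>\<epsilon>\<in>J. ennreal (c x \<epsilon>)) \<noteq> \<top>"
      using J by (auto simp: ennreal_prod_eq_top)
  next
    fix x A assume A: "A \<in> sets (prob_algebra unit_leb)"
    \<comment> \<open>The likelihood is regrouped from observations to words. Moving
      \<open>ennreal\<close> through the products requires nonnegative factors, hence the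
      restriction to \<open>y\<close> with coordinates in the unit interval.\<close>
    have hg: "h y x = (\<Prod>\<epsilon>\<in>J. g x \<epsilon> (y \<epsilon>))" if "y \<in> space (PiM J S)" for y
    proof -
      have nn: "0 \<le> split_density \<epsilon> (y \<epsilon>) t" if "\<epsilon> \<in> J" for \<epsilon> t
        using coord that \<open>y \<in> space (PiM J S)\<close> by (intro split_density_nonneg)
      have "h y x = ennreal (\<Prod>i<n. \<Prod>\<epsilon>\<in>J. split_density \<epsilon> (y \<epsilon>) (x i))"
        unfolding h_def using nn by (intro prod_ennreal prod_nonneg) auto
      also have "\<dots> = ennreal (\<Prod>\<epsilon>\<in>J. \<Prod>i<n. split_density \<epsilon> (y \<epsilon>) (x i))"
        by (subst prod.swap) simp
      also have "\<dots> = (\<Prod>\<epsilon>\<in>J. ennreal (\<Prod>i<n. split_density \<epsilon> (y \<epsilon>) (x i)))"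
        using nn by (intro prod_ennreal[symmetric] prod_nonneg) auto
      finally show ?thesis by (simp only: prod_split_density g_def)
    qed
    have gm: "(\<lambda>y. \<Prod>\<epsilon>\<in>J. g x \<epsilon> (y \<epsilon>)) \<in> borel_measurable (PiM J S)"
      by (intro borel_measurable_prod_ennreal measurable_compose[OF measurable_component_singleton])
        (auto intro: g_meas)
    have ind: "(\<lambda>y. indicator A (tree_measure L y) :: ennreal) \<in> borel_measurable (PiM J S)"
        "(\<lambda>y. indicator A (tree_measure L y) :: ennreal) \<in> borel_measurable (PiM J (S' x))"
      using T A by (auto simp: R_def intro!: measurable_compose[OF _ borel_measurable_indicator])
    \<comment> \<open>The likelihood is absorbed as a density, \<open>update\<close> exchanges the
      prior law of the splitting variables for the posterior one, and the image under
      \<open>tree_measure L\<close> leads back to random measures.\<close>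
    have "(\<integral>\<^sup>+y. h y x * indicator A (tree_measure L y) \<partial>PiM J S) =
        (\<integral>\<^sup>+y. indicator A (tree_measure L y) \<partial>density (PiM J S) (\<lambda>y. \<Prod>\<epsilon>\<in>J. g x \<epsilon> (y \<epsilon>)))"
      by (subst nn_integral_density[OF gm ind(1)]) (auto intro!: nn_integral_cong simp: hg)
    also have "\<dots> = (\<Prod>\<epsilon>\<in>J. ennreal (c x \<epsilon>)) *
        (\<integral>\<^sup>+y. indicator A (tree_measure L y) \<partial>PiM J (S' x))"
      unfolding update using ind(2) by (simp add: nn_integral_density nn_integral_cmult)
    also have "(\<integral>\<^sup>+y. indicator A (tree_measure L y) \<partial>PiM J (S' x)) =
        (\<integral>\<^sup>+P. indicator A P \<partial>distr (PiM J (S' x)) (prob_algebra unit_leb) (tree_measure L))"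
      using T A by (intro nn_integral_distr[symmetric]) (auto simp: R_def)
    also have "\<dots> = emeasure (distr (PiM J (S' x)) (prob_algebra unit_leb) (tree_measure L)) A"
      using A by simp
    finally show "(\<integral>\<^sup>+y. h y x * indicator A (tree_measure L y) \<partial>PiM J S) =
        (\<Prod>\<epsilon>\<in>J. ennreal (c x \<epsilon>)) *
        emeasure (distr (PiM J (S' x)) (prob_algebra unit_leb) (tree_measure L)) A" .
  qed
  moreover have "sspt_params L (post_p n x \<pi> \<alpha>) (post_a n x \<alpha>)" for x
    using conj(3) a' by (auto simp: sspt_params_def J_def)
  ultimately show ?thesis by (simp add: sspt_def J_def S_def[abs_def] S'_def[abs_def])
qed

end
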